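(* Let $L$ be a decomposable lattice such that each prime ideal of $L$ contains only a finite number of minimal prime ideals. Then the following conditions are equivalent: (1) Every minimal prime ideal of $L$ is regular, i.e. $MinSpe(L)\subseteq V(L)$. (2) $V(L)$ is atomic, i.e. every regular ideal of $L$ contains a minimal regular ideal.
   Context: A decomposable lattice is a distributive lattice $L$ with minimum element $0$ such that for any $a,b\in L$ that are not comparable there exist $\overline{a},\overline{b}\in L$ with $a=\overline{a}\vee(a\wedge b)$, $b=\overline{b}\vee(a\wedge b)$ and $\overline{a}\wedge\overline{b}=0$. An ideal of $L$ is a nonempty subset closed under $\vee$ and downward closed. An ideal $P$ is prime if $P\neq L$ and $a\wedge b\in P$ implies $a\in P$ or $b\in P$. $MinSpe(L)$ is the set of prime ideals that are minimal under inclusion among prime ideals. A regular ideal is an ideal which, for some $0<x\in L$, is maximal (under inclusion) among the ideals of $L$ not containing $x$; $V(L)$ is the set of all regular ideals, ordered by inclusion. A minimal regular ideal is a minimal element of $V(L)$. *)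

theory Defs
  imports Main
begin

class decomposable_lattice = distrib_lattice + order_bot +
  assumes decomposable:
    "\<not> a \<le> b \<Longrightarrow> \<not> b \<le> a \<Longrightarrow>
      \<exists>a' b'. a = sup a' (inf a b) \<and> b = sup b' (inf a b) \<and> inf a' b' = bot"

definition lattice_ideal :: "'a::lattice set \<Rightarrow> bool" where
  "lattice_ideal I \<longleftrightarrow>
     I \<noteq> {} \<and> (\<forall>a\<in>I. \<forall>b\<in>I. sup a b \<in> I) \<and> (\<forall>a b. b \<in> I \<longrightarrow> a \<le> b \<longrightarrow> a \<in> I)"

definition prime_lattice_ideal :: "'a::lattice set \<Rightarrow> bool" where
  "prime_lattice_ideal P \<longleftrightarrow>
     lattice_ideal P \<and> P \<noteq> UNIV \<and> (\<forall>a b. inf a b \<in> P \<longrightarrow> a \<in> P \<or> b \<in> P)"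

definition MinSpe :: "'a::lattice set set" where
  "MinSpe = {P. prime_lattice_ideal P \<and> (\<forall>Q. prime_lattice_ideal Q \<longrightarrow> Q \<subseteq> P \<longrightarrow> Q = P)}"

definition regular_ideals :: "'a::{lattice, order_bot} set set" where
  "regular_ideals = {I. \<exists>x. bot < x \<and> lattice_ideal I \<and> x \<notin> I \<and>
     (\<forall>J. lattice_ideal J \<longrightarrow> x \<notin> J \<longrightarrow> I \<subseteq> J \<longrightarrow> J = I)}"

definition minimal_regular_ideals :: "'a::{lattice, order_bot} set set" where
  "minimal_regular_ideals =
     {M \<in> regular_ideals. \<forall>I \<in> regular_ideals. I \<subseteq> M \<longrightarrow> I = M}"

end

theory Submission imports Defs begin

text \<open>
  Decomposability makes the ideals above a prime ideal \<open>P\<close> very rigid: for incomparable \<open>a\<close> and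
  \<open>b\<close> one of the disjoint parts \<open>a'\<close>, \<open>b'\<close> lies in \<open>P\<close>, so modulo \<open>P\<close> one of \<open>a\<close>, \<open>b\<close> is the
  meet of the two. Hence the ideals containing \<open>P\<close> form a chain under inclusion
  (\<open>ideals_above_prime_chain\<close>). Zorn's lemma contributes two facts: every ideal
  is the intersection of the regular ideals above it (\<open>regular_ideal_separates\<close>), and every prime
  ideal contains a minimal one (\<open>minimal_prime_below_prime\<close>).

  If all minimal primes are regular, then a minimal prime below a regular ideal is a minimal
  regular ideal, since regular ideals are prime. So regular ideals are atomic.

  Conversely, let \<open>P\<close> be a minimal prime. Among the regular ideals above \<open>P\<close> let \<open>I\<close> have the
  fewest minimal primes below it; this number is finite by hypothesis. A regular ideal \<open>J\<close> with
  \<open>P \<subseteq> J \<subseteq> I\<close> then has exactly the same minimal primes below it as \<open>I\<close>. Pick a minimal regular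
  \<open>M \<subseteq> I\<close> and a minimal prime \<open>Q \<subseteq> M\<close>. Then \<open>Q \<subseteq> J\<close> as well, so \<open>M\<close> and \<open>J\<close> lie in the chain
  above \<open>Q\<close>, and minimality of \<open>M\<close> gives \<open>M \<subseteq> J\<close>. Therefore \<open>M\<close> is contained in every regular
  ideal above \<open>P\<close>, that is, in \<open>P\<close>. As \<open>M\<close> is prime and \<open>P\<close> is a minimal prime, \<open>P = M\<close> is regular.
\<close>

section \<open>Regular ideals are prime and separate points from ideals\<close>

lemma lattice_ideal_sup: "lattice_ideal I \<Longrightarrow> a \<in> I \<Longrightarrow> b \<in> I \<Longrightarrow> sup a b \<in> I"
  by (simp add: lattice_ideal_def)

lemma lattice_ideal_down: "lattice_ideal I \<Longrightarrow> b \<in> I \<Longrightarrow> a \<le> b \<Longrightarrow> a \<in> I"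
  by (auto simp: lattice_ideal_def)

lemma lattice_ideal_bot:
  fixes I :: "'a::{lattice, order_bot} set"
  shows "lattice_ideal I \<Longrightarrow> bot \<in> I"
  using bot_least by (fastforce simp: lattice_ideal_def)

lemma regular_ideal_lattice_ideal: "I \<in> regular_ideals \<Longrightarrow> lattice_ideal I"
  by (auto simp: regular_ideals_def)

text \<open>The ideal generated by \<open>I\<close> and \<open>a\<close>.\<close>

lemma lattice_ideal_adjoin:
  assumes "lattice_ideal I"
  shows "lattice_ideal {y. \<exists>i\<in>I. y \<le> sup i a}"
  unfolding lattice_ideal_def
proof (intro conjI ballI allI impI)
  show "{y. \<exists>i\<in>I. y \<le> sup i a} \<noteq> {}"
    using assms by (auto simp: lattice_ideal_def)
next
  fix y z assume "y \<in> {y. \<exists>i\<in>I. y \<le> sup i a}" "z \<in> {y. \<exists>i\<in>I. y \<le> sup i a}"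
  then obtain i j where ij: "i \<in> I" "j \<in> I" "y \<le> sup i a" "z \<le> sup j a"
    by blast
  have "sup y z \<le> sup (sup i a) (sup j a)"
    using ij by (intro sup_mono)
  also have "\<dots> = sup (sup i j) a"
    by (simp add: sup.commute sup.left_commute)
  finally show "sup y z \<in> {y. \<exists>i\<in>I. y \<le> sup i a}"
    using lattice_ideal_sup[OF assms ij(1,2)] by blast
next
  fix y z assume "z \<in> {y. \<exists>i\<in>I. y \<le> sup i a}" "y \<le> z"
  then show "y \<in> {y. \<exists>i\<in>I. y \<le> sup i a}"
    by (auto intro: order_trans)
qed

text \<open>If \<open>I\<close> is maximal without \<open>x\<close> and \<open>a, b \<notin> I\<close>, then \<open>x\<close> lies in both ideals generated by
  \<open>I\<close> and one of \<open>a\<close>, \<open>b\<close>; by distributivity it lies in the one generated by \<open>I\<close> and \<open>inf a b\<close>.\<close>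

lemma regular_ideal_prime:
  fixes I :: "'a::{distrib_lattice, order_bot} set"
  assumes "I \<in> regular_ideals"
  shows "prime_lattice_ideal I"
proof -
  obtain x where x: "lattice_ideal I" "x \<notin> I"
    and max: "\<And>J. lattice_ideal J \<Longrightarrow> x \<notin> J \<Longrightarrow> I \<subseteq> J \<Longrightarrow> J = I"
    using assms by (auto simp: regular_ideals_def)
  have below: "\<exists>i\<in>I. x \<le> sup i a" if "a \<notin> I" for a
  proof (rule ccontr)
    assume "\<not> ?thesis"
    moreover have "I \<subseteq> {y. \<exists>i\<in>I. y \<le> sup i a}"
      using sup_ge1 by blast
    ultimately have "{y. \<exists>i\<in>I. y \<le> sup i a} = I"
      using max[OF lattice_ideal_adjoin[OF x(1)]] by simp
    moreover have "a \<in> {y. \<exists>i\<in>I. y \<le> sup i a}"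
      using x(1) by (auto simp: lattice_ideal_def)
    ultimately show False
      using that by simp
  qed
  have "a \<in> I \<or> b \<in> I" if "inf a b \<in> I" for a b
  proof (rule ccontr)
    assume "\<not> ?thesis"
    then obtain i j where ij: "i \<in> I" "j \<in> I" "x \<le> sup i a" "x \<le> sup j b"
      using below by blast
    have "x \<le> inf (sup (sup i j) a) (sup (sup i j) b)"
      using ij(3,4) by (meson le_inf_iff order_trans sup_ge1 sup_ge2 sup_mono order_refl)
    also have "\<dots> = sup (sup i j) (inf a b)"
      by (simp add: sup_inf_distrib1)
    finally have "x \<in> I"
      using ij(1,2) that x(1) by (blast intro: lattice_ideal_down lattice_ideal_sup)
    with x(2) show False ..
  qed
  then show ?thesis
    using x by (auto simp: prime_lattice_ideal_def)
qed

text \<open>Zorn's lemma for the ideals above \<open>I\<close> that avoid \<open>x\<close>.\<close>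

lemma regular_ideal_separates:
  fixes I :: "'a::{lattice, order_bot} set"
  assumes "lattice_ideal I" "x \<notin> I"
  obtains M where "M \<in> regular_ideals" "I \<subseteq> M" "x \<notin> M"
proof -
  let ?A = "{J. lattice_ideal J \<and> I \<subseteq> J \<and> x \<notin> J}"
  have "\<exists>M\<in>?A. \<forall>J\<in>?A. M \<subseteq> J \<longrightarrow> J = M"
  proof (rule subset_Zorn_nonempty)
    show "?A \<noteq> {}"
      using assms by blast
  next
    fix C assume C: "C \<noteq> {}" "subset.chain ?A C"
    have mem: "J \<in> ?A" if "J \<in> C" for J
      using C(2) that by (auto simp: subset_chain_def)
    have "lattice_ideal (\<Union>C)"
      unfolding lattice_ideal_def
    proof (intro conjI ballI allI impI)
      show "\<Union>C \<noteq> {}"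
        using C(1) mem by (fastforce simp: lattice_ideal_def)
    next
      fix a b assume "a \<in> \<Union>C" "b \<in> \<Union>C"
      then obtain J where "J \<in> C" "a \<in> J" "b \<in> J"
        using C(2) unfolding subset_chain_def by blast
      then show "sup a b \<in> \<Union>C"
        using mem lattice_ideal_sup by blast
    next
      fix a b assume "b \<in> \<Union>C" "a \<le> b"
      then show "a \<in> \<Union>C"
        using mem lattice_ideal_down by blast
    qed
    then show "\<Union>C \<in> ?A"
      using C(1) mem by blast
  qed
  then obtain M where M: "lattice_ideal M" "I \<subseteq> M" "x \<notin> M"
    and max: "\<forall>J\<in>?A. M \<subseteq> J \<longrightarrow> J = M"
    by auto
  have "bot < x"
    using M(3) lattice_ideal_bot[OF M(1)] bot.not_eq_extremum by blast
  then have "M \<in> regular_ideals"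
    unfolding regular_ideals_def
  proof (intro CollectI exI conjI allI impI)
    fix J assume "lattice_ideal J" "x \<notin> J" "M \<subseteq> J"
    then show "J = M"
      using max M(2) by simp
  qed (use M in auto)
  with M that show ?thesis
    by blast
qed

section \<open>Minimal primes\<close>

text \<open>If \<open>a\<close> is outside one member of the chain and \<open>b\<close> outside another, then both are outside
  the smaller of these two primes, and so is their meet.\<close>

lemma prime_ideal_Inter_chain:
  fixes C :: "'a::{lattice, order_bot} set set"
  assumes "C \<noteq> {}" and prime: "\<And>Q. Q \<in> C \<Longrightarrow> prime_lattice_ideal Q"
    and chain: "\<And>Q R. Q \<in> C \<Longrightarrow> R \<in> C \<Longrightarrow> Q \<subseteq> R \<or> R \<subseteq> Q"
  shows "prime_lattice_ideal (\<Inter>C)"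
proof -
  have ideal: "lattice_ideal Q" if "Q \<in> C" for Q
    using prime[OF that] by (simp add: prime_lattice_ideal_def)
  have "bot \<in> \<Inter>C"
    using ideal lattice_ideal_bot by blast
  then have "lattice_ideal (\<Inter>C)"
    unfolding lattice_ideal_def
    using ideal by (blast intro: lattice_ideal_sup lattice_ideal_down)
  moreover have "\<Inter>C \<noteq> UNIV"
    using assms(1) prime by (auto simp: prime_lattice_ideal_def)
  moreover have "a \<in> \<Inter>C \<or> b \<in> \<Inter>C" if "inf a b \<in> \<Inter>C" for a b
  proof (rule ccontr)
    assume "\<not> ?thesis"
    then obtain Q R where "Q \<in> C" "R \<in> C" "a \<notin> Q" "b \<notin> R"
      by blast
    then obtain S where "S \<in> C" "a \<notin> S" "b \<notin> S"
      using chain by blast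
    then show False
      using prime that by (auto simp: prime_lattice_ideal_def)
  qed
  ultimately show ?thesis
    by (simp add: prime_lattice_ideal_def)
qed

text \<open>Zorn's lemma yields maximal sets, so it is applied to complements of primes.\<close>

lemma minimal_prime_below_prime:
  fixes P :: "'a::{lattice, order_bot} set"
  assumes "prime_lattice_ideal P"
  obtains Q where "Q \<in> MinSpe" "Q \<subseteq> P"
proof -
  let ?A = "{N. prime_lattice_ideal (- N) \<and> - N \<subseteq> P}"
  have "\<exists>N\<in>?A. \<forall>N'\<in>?A. N \<subseteq> N' \<longrightarrow> N' = N"
  proof (rule subset_Zorn_nonempty)
    have "- P \<in> ?A"
      using assms by simp
    then show "?A \<noteq> {}"
      by blast
  next
    fix C assume C: "C \<noteq> {}" "subset.chain ?A C"
    have "prime_lattice_ideal (\<Inter>(uminus ` C))"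
    proof (rule prime_ideal_Inter_chain)
      show "uminus ` C \<noteq> {}"
        using C(1) by simp
      show "prime_lattice_ideal Q" if "Q \<in> uminus ` C" for Q
        using C(2) that by (auto simp: subset_chain_def)
      show "Q \<subseteq> R \<or> R \<subseteq> Q" if "Q \<in> uminus ` C" "R \<in> uminus ` C" for Q R
      proof -
        obtain N N' where "N \<in> C" "N' \<in> C" and QR: "Q = - N" "R = - N'"
          using \<open>Q \<in> uminus ` C\<close> \<open>R \<in> uminus ` C\<close> by blast
        then have "N \<subseteq> N' \<or> N' \<subseteq> N"
          using C(2) by (simp add: subset_chain_def)
        then show ?thesis
          unfolding QR by blast
      qed
    qed
    moreover have "\<Inter>(uminus ` C) \<subseteq> P"
      using C by (auto simp: subset_chain_def)
    moreover have "\<Inter>(uminus ` C) = - \<Union>C"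
      by blast
    ultimately show "\<Union>C \<in> ?A"
      by simp
  qed
  then obtain N where N: "prime_lattice_ideal (- N)" "- N \<subseteq> P"
    and max: "\<forall>N'\<in>?A. N \<subseteq> N' \<longrightarrow> N' = N"
    by auto
  have "R = - N" if "prime_lattice_ideal R" "R \<subseteq> - N" for R
  proof -
    have "- R \<in> ?A" "N \<subseteq> - R"
      using that N(2) by auto
    then have "- R = N"
      using max by simp
    then show ?thesis
      by auto
  qed
  then have "- N \<in> MinSpe"
    using N(1) by (simp add: MinSpe_def)
  with N(2) that show ?thesis
    by blast
qed

section \<open>The chain of ideals above a prime\<close>

text \<open>With \<open>a\<close> in the first ideal only and \<open>b\<close> in the second only, one of the
  disjoint parts \<open>a'\<close> and \<open>b'\<close> lies in \<open>P\<close>, hence in both ideals; joined with \<open>inf a b\<close> it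
  puts \<open>a\<close> or \<open>b\<close> in the ideal that was to miss it.\<close>

lemma ideals_above_prime_chain:
  fixes P :: "'a::decomposable_lattice set"
  assumes P: "prime_lattice_ideal P"
    and I: "lattice_ideal I" "P \<subseteq> I" and J: "lattice_ideal J" "P \<subseteq> J"
  shows "I \<subseteq> J \<or> J \<subseteq> I"
proof (rule ccontr)
  assume "\<not> ?thesis"
  then obtain a b where a: "a \<in> I" "a \<notin> J" and b: "b \<in> J" "b \<notin> I"
    by blast
  have "\<not> a \<le> b" "\<not> b \<le> a"
    using a b I(1) J(1) lattice_ideal_down by blast+
  then obtain a' b' where ab: "a = sup a' (inf a b)" "b = sup b' (inf a b)" "inf a' b' = bot"
    using decomposable by blast
  have meet: "inf a b \<in> I" "inf a b \<in> J"
    using lattice_ideal_down[OF I(1) a(1) inf_le1] lattice_ideal_down[OF J(1) b(1) inf_le2]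
    by simp_all
  have "inf a' b' \<in> P"
    using P by (simp add: ab(3) lattice_ideal_bot prime_lattice_ideal_def)
  then consider "a' \<in> P" | "b' \<in> P"
    using P by (auto simp: prime_lattice_ideal_def)
  then show False
  proof cases
    case 1
    then have "sup a' (inf a b) \<in> J"
      using J meet lattice_ideal_sup by blast
    with ab(1) a(2) show False
      by simp
  next
    case 2
    then have "sup b' (inf a b) \<in> I"
      using I meet lattice_ideal_sup by blast
    with ab(2) b(2) show False
      by simp
  qed
qed

section \<open>Atomicity and regularity of minimal primes\<close>

text \<open>The finiteness hypothesis enters here: it provides a regular ideal above \<open>P\<close> below which the set of minimal
  primes does not shrink any further.\<close>

lemma regular_ideal_stable_minimal_primes:
  fixes P :: "'a::{distrib_lattice, order_bot} set"
  assumes fin: "\<And>P :: 'a set. prime_lattice_ideal P \<Longrightarrow> finite {Q \<in> MinSpe. Q \<subseteq> P}"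
    and P: "prime_lattice_ideal P"
  obtains I where "I \<in> regular_ideals" "P \<subseteq> I"
    "\<And>J Q. J \<in> regular_ideals \<Longrightarrow> P \<subseteq> J \<Longrightarrow> J \<subseteq> I \<Longrightarrow> Q \<in> MinSpe \<Longrightarrow> Q \<subseteq> I \<Longrightarrow> Q \<subseteq> J"
proof -
  let ?B = "\<lambda>I. {Q \<in> MinSpe. Q \<subseteq> I}"
  obtain x where "lattice_ideal P" "x \<notin> P"
    using P by (auto simp: prime_lattice_ideal_def)
  then obtain I\<^sub>0 where "I\<^sub>0 \<in> regular_ideals \<and> P \<subseteq> I\<^sub>0"
    using regular_ideal_separates by blast
  then obtain I where I: "I \<in> regular_ideals" "P \<subseteq> I"
    and least: "\<And>J. J \<in> regular_ideals \<Longrightarrow> P \<subseteq> J \<Longrightarrow> card (?B I) \<le> card (?B J)"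
    using ex_has_least_nat[of "\<lambda>I. I \<in> regular_ideals \<and> P \<subseteq> I" I\<^sub>0 "\<lambda>I. card (?B I)"]
    by blast
  have "?B J = ?B I" if "J \<in> regular_ideals" "P \<subseteq> J" "J \<subseteq> I" for J
  proof (rule card_seteq)
    show "finite (?B I)"
      using fin[OF regular_ideal_prime[OF I(1)]] .
    show "?B J \<subseteq> ?B I"
      using that(3) by blast
    show "card (?B I) \<le> card (?B J)"
      using least that by blast
  qed
  with I that show ?thesis
    by blast
qed

lemma minimal_prime_regular_if_atomic:
  fixes P :: "'a::decomposable_lattice set"
  assumes fin: "\<And>P :: 'a set. prime_lattice_ideal P \<Longrightarrow> finite {Q \<in> MinSpe. Q \<subseteq> P}"
    and atomic: "\<And>I :: 'a set. I \<in> regular_ideals \<Longrightarrow> \<exists>M \<in> minimal_regular_ideals. M \<subseteq> I"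
    and P: "P \<in> MinSpe"
  shows "P \<in> regular_ideals"
proof -
  have P_prime: "prime_lattice_ideal P" and P_ideal: "lattice_ideal P"
    using P by (auto simp: MinSpe_def prime_lattice_ideal_def)
  obtain I where I: "I \<in> regular_ideals" "P \<subseteq> I"
    and stable: "\<And>J Q. J \<in> regular_ideals \<Longrightarrow> P \<subseteq> J \<Longrightarrow> J \<subseteq> I \<Longrightarrow> Q \<in> MinSpe \<Longrightarrow> Q \<subseteq> I \<Longrightarrow> Q \<subseteq> J"
    using regular_ideal_stable_minimal_primes[OF fin P_prime] by blast
  obtain M where M: "M \<in> regular_ideals" "M \<subseteq> I"
    and M_min: "\<And>J. J \<in> regular_ideals \<Longrightarrow> J \<subseteq> M \<Longrightarrow> J = M"
    using atomic[OF I(1)] by (auto simp: minimal_regular_ideals_def)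
  obtain Q where Q: "Q \<in> MinSpe" "Q \<subseteq> M"
    using minimal_prime_below_prime[OF regular_ideal_prime[OF M(1)]] .
  have Q_prime: "prime_lattice_ideal Q"
    using Q(1) by (simp add: MinSpe_def)
  have "M \<subseteq> J" if J: "J \<in> regular_ideals" "P \<subseteq> J" for J
  proof -
    have "I \<subseteq> J \<or> J \<subseteq> I"
      using ideals_above_prime_chain[OF P_prime] I J by (blast intro: regular_ideal_lattice_ideal)
    then show ?thesis
    proof
      assume "I \<subseteq> J"
      with M(2) show ?thesis
        by blast
    next
      assume "J \<subseteq> I"
      then have "Q \<subseteq> J"
        using stable J Q M(2) by blast
      then have "M \<subseteq> J \<or> J \<subseteq> M"
        using ideals_above_prime_chain[OF Q_prime] M(1) J(1) Q(2)
        by (blast intro: regular_ideal_lattice_ideal)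
      then show ?thesis
        using M_min J(1) by blast
    qed
  qed
  then have "M \<subseteq> P"
    using regular_ideal_separates[OF P_ideal] by blast
  then have "M = P"
    using P regular_ideal_prime[OF M(1)] by (simp add: MinSpe_def)
  with M(1) show ?thesis
    by simp
qed

lemma atomic_if_minimal_primes_regular:
  fixes I :: "'a::{distrib_lattice, order_bot} set"
  assumes "(MinSpe :: 'a set set) \<subseteq> regular_ideals" "I \<in> regular_ideals"
  shows "\<exists>M \<in> minimal_regular_ideals. M \<subseteq> I"
proof -
  obtain Q where Q: "Q \<in> MinSpe" "Q \<subseteq> I"
    using minimal_prime_below_prime[OF regular_ideal_prime[OF assms(2)]] .
  have "Q \<in> minimal_regular_ideals"
    using Q(1) assms(1) regular_ideal_prime unfolding minimal_regular_ideals_def MinSpe_def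
    by blast
  with Q(2) show ?thesis
    by blast
qed

theorem theorem4p10:
  assumes "\<And>P :: 'a::decomposable_lattice set. prime_lattice_ideal P \<Longrightarrow> finite {Q \<in> MinSpe. Q \<subseteq> P}"
  shows "(MinSpe :: 'a set set) \<subseteq> regular_ideals \<longleftrightarrow>
    (\<forall>I \<in> (regular_ideals :: 'a set set). \<exists>M \<in> minimal_regular_ideals. M \<subseteq> I)"
proof (intro iffI ballI subsetI)
  fix I :: "'a set" assume "(MinSpe :: 'a set set) \<subseteq> regular_ideals" "I \<in> regular_ideals"
  then show "\<exists>M \<in> minimal_regular_ideals. M \<subseteq> I"
    by (rule atomic_if_minimal_primes_regular)
next
  fix P :: "'a set"
  assume atomic: "\<forall>I \<in> (regular_ideals :: 'a set set). \<exists>M \<in> minimal_regular_ideals. M \<subseteq> I"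
    and P: "P \<in> MinSpe"
  show "P \<in> regular_ideals"
    by (rule minimal_prime_regular_if_atomic[OF assms bspec[OF atomic] P])
qed

end
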